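(* Let $V$ be a vacuum-free vertex algebra and let $W$ be a vector space equipped with a linear map $Y_W(\cdot,x):V\to(\mathrm{End}\,W)[[x,x^{-1}]]$, $v\mapsto Y_W(v,x)=\sum_{n\in\mathbb Z}v_nx^{-n-1}$, such that $Y_W(u,x)w\in W((x))$ for all $u\in V$, $w\in W$. Then weak associativity together with vacuum-free skew-symmetry can replace the Jacobi identity in the definition of module for a vacuum-free vertex algebra; that is, the Jacobi identity $$x_0^{-1}\delta\left(\frac{x_1-x_2}{x_0}\right)Y_W(u,x_1)Y_W(v,x_2)w-x_0^{-1}\delta\left(\frac{-x_2+x_1}{x_0}\right)Y_W(v,x_2)Y_W(u,x_1)w=x_1^{-1}\delta\left(\frac{x_2+x_0}{x_1}\right)Y_W(Y(u,x_0)v,x_2)w$$ holds for all $u,v\in V$, $w\in W$ if and only if both of the following hold: (weak associativity) for all $u,v\in V$, $w\in W$ there exists an integer $m\ge0$ such that $(x_0+x_2)^{m}\left(Y_W(u,x_0+x_2)Y_W(v,x_2)w-Y_W(Y(u,x_0)v,x_2)w\right)=0$; (vacuum-free skew-symmetry) for all $u,v\in V$, $Y_W(Y(u,x_0)v,x_2)=Y_W(Y(v,-x_0)u,x_2+x_0)$.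
   Context: All vector spaces are over $\mathbb C$; formal variables commute. For a vector space $U$, $U[[x,x^{-1}]]$ is the space of all formal Laurent series $\sum_{n\in\mathbb Z}u_nx^n$ with $u_n\in U$; $U((x))$ is the subspace of series with $u_n=0$ for $n$ sufficiently negative. $\delta(x)=\sum_{n\in\mathbb Z}x^n$. Binomial expansion convention: for every $n\in\mathbb Z$, $(x+y)^n=\sum_{k\ge0}\binom nk x^{n-k}y^k$, i.e. binomials are expanded in nonnegative powers of the second-listed variable (likewise with signs, so $(x_1-x_2)^n$ is expanded in nonnegative powers of $x_2$ and $(-x_2+x_1)^n$ in nonnegative powers of $x_1$); this applies inside $\delta$ and to substitutions such as $F(x+y)$. Vertex operator maps are extended coefficientwise to series: $Y_W(Y(u,x_0)v,x_2)=\sum_n Y_W(u_nv,x_2)x_0^{-n-1}$. A vacuum-free vertex algebra is a vector space $V$ with an injective linear map $Y(\cdot,x):V\to(\mathrm{End}\,V)[[x,x^{-1}]]$, $v\mapsto Y(v,x)=\sum_{n\in\mathbb Z}v_nx^{-n-1}$, such that $Y(u,x)v\in V((x))$ for all $u,v\in V$ and the Jacobi identity holds for all $u,v\in V$: $$x_0^{-1}\delta\left(\tfrac{x_1-x_2}{x_0}\right)Y(u,x_1)Y(v,x_2)-x_0^{-1}\delta\left(\tfrac{-x_2+x_1}{x_0}\right)Y(v,x_2)Y(u,x_1)=x_1^{-1}\delta\left(\tfrac{x_2+x_0}{x_1}\right)Y(Y(u,x_0)v,x_2).$$ A module for a vacuum-free vertex algebra $V$ is a vector space $W$ with a linear map $Y_W(\cdot,x):V\to(\mathrm{End}\,W)[[x,x^{-1}]]$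 such that $Y_W(u,x)w\in W((x))$ for all $u\in V$, $w\in W$ and the module Jacobi identity (displayed in the claim) holds. *)

theory Defs
  imports Complex_Main "HOL-Library.Product_Plus" "HOL-Library.Groups_Big_Fun"
begin

text \<open>
  A formal series in \<open>k\<close> variables with coefficients in \<open>U\<close>, unbounded in both directions, is the
  function sending an exponent tuple in \<open>\<int>\<^sup>k\<close> to the coefficient of that monomial. Exponents in two
  variables are ordered \<open>(x\<^sub>0, x\<^sub>2)\<close>, in three variables \<open>(x\<^sub>0, x\<^sub>1, x\<^sub>2)\<close>.

  A vertex operator map is \<open>Y :: 'v \<Rightarrow> int \<Rightarrow> 'w \<Rightarrow> 'w\<close>, where \<open>Y v n\<close> is the coefficient of \<open>x\<^sup>n\<close>
  in \<open>Y(v,x)\<close>; the mode \<open>v\<^sub>n\<close> is therefore \<open>Y v (- n - 1)\<close>.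

  Coefficient sums are written with \<^const>\<open>Sum_any\<close>, which is the sum over the support when that is
  finite. In every series below the support is finite as soon as the vertex operator maps are
  linear and lower truncated.
\<close>

type_synonym ('v, 'w) vertex_map = "'v \<Rightarrow> int \<Rightarrow> 'w \<Rightarrow> 'w"

text \<open>Coefficient of \<open>x\<^sup>i y\<^sup>j\<close> in \<open>(s x + t y)\<^sup>n\<close>, expanded in nonnegative powers of \<open>y\<close>.\<close>

definition binom_pow :: "complex \<Rightarrow> complex \<Rightarrow> int \<Rightarrow> int \<Rightarrow> int \<Rightarrow> complex" where
  "binom_pow s t n i j =
     (if 0 \<le> j \<and> i + j = n then (of_int n gchoose nat j) * s powi i * t powi j else 0)"

definition formal_delta :: "int \<Rightarrow> complex" where
  "formal_delta n = 1"

text \<open>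
  Coefficient of \<open>z\<^sup>a x\<^sup>b y\<^sup>c\<close> in
  \<open>z\<^sup>-\<^sup>1 \<delta>((s x + t y) / z) = (\<Sum>n. z\<^sup>-\<^sup>n\<^sup>-\<^sup>1 (s x + t y)\<^sup>n)\<close>: only \<open>n = - a - 1\<close> contributes.
\<close>

definition delta_quot :: "complex \<Rightarrow> complex \<Rightarrow> int \<Rightarrow> int \<Rightarrow> int \<Rightarrow> complex" where
  "delta_quot s t a b c = formal_delta (- a - 1) * binom_pow s t (- a - 1) b c"

text \<open>Product of formal series with respect to a bilinear operation on the coefficients.\<close>

definition series_mult ::
  "('a \<Rightarrow> 'b \<Rightarrow> 'c) \<Rightarrow> ('e::ab_group_add \<Rightarrow> 'a) \<Rightarrow> ('e \<Rightarrow> 'b) \<Rightarrow> 'e \<Rightarrow> 'c::comm_monoid_add" where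
  "series_mult f A B e = Sum_any (\<lambda>d. f (A d) (B (e - d)))"

text \<open>\<open>x\<^sub>0\<^sup>-\<^sup>1 \<delta>((x\<^sub>1 - x\<^sub>2) / x\<^sub>0)\<close>, \<open>x\<^sub>0\<^sup>-\<^sup>1 \<delta>((- x\<^sub>2 + x\<^sub>1) / x\<^sub>0)\<close> and \<open>x\<^sub>1\<^sup>-\<^sup>1 \<delta>((x\<^sub>2 + x\<^sub>0) / x\<^sub>1)\<close>.\<close>

definition delta_12_0 :: "int \<times> int \<times> int \<Rightarrow> complex" where
  "delta_12_0 = (\<lambda>(a, b, c). delta_quot 1 (- 1) a b c)"

definition delta_21_0 :: "int \<times> int \<times> int \<Rightarrow> complex" where
  "delta_21_0 = (\<lambda>(a, b, c). delta_quot (- 1) 1 a c b)"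

definition delta_20_1 :: "int \<times> int \<times> int \<Rightarrow> complex" where
  "delta_20_1 = (\<lambda>(a, b, c). delta_quot 1 1 b c a)"

text \<open>
  \<open>Y\<^sub>W(u,x\<^sub>1) Y\<^sub>W(v,x\<^sub>2) w\<close>, \<open>Y\<^sub>W(v,x\<^sub>2) Y\<^sub>W(u,x\<^sub>1) w\<close> and \<open>Y\<^sub>W(Y(u,x\<^sub>0)v,x\<^sub>2) w\<close> as series in
  \<open>(x\<^sub>0, x\<^sub>1, x\<^sub>2)\<close>, each constant in the variable that does not occur.
\<close>

definition prod_12 ::
  "('v, 'w::zero) vertex_map \<Rightarrow> 'v \<Rightarrow> 'v \<Rightarrow> 'w \<Rightarrow> int \<times> int \<times> int \<Rightarrow> 'w" where
  "prod_12 YW u v w = (\<lambda>(i, j, k). if i = 0 then YW u j (YW v k w) else 0)"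

definition prod_21 ::
  "('v, 'w::zero) vertex_map \<Rightarrow> 'v \<Rightarrow> 'v \<Rightarrow> 'w \<Rightarrow> int \<times> int \<times> int \<Rightarrow> 'w" where
  "prod_21 YW u v w = (\<lambda>(i, j, k). if i = 0 then YW v k (YW u j w) else 0)"

definition iterate_02 ::
  "('v, 'v) vertex_map \<Rightarrow> ('v, 'w::zero) vertex_map \<Rightarrow> 'v \<Rightarrow> 'v \<Rightarrow> 'w \<Rightarrow> int \<times> int \<times> int \<Rightarrow> 'w" where
  "iterate_02 Y YW u v w = (\<lambda>(i, j, k). if j = 0 then YW (Y u i v) k w else 0)"

definition jacobi_identity ::
  "(complex \<Rightarrow> 'w \<Rightarrow> 'w) \<Rightarrow> ('v, 'v) vertex_map \<Rightarrow> ('v, 'w::ab_group_add) vertex_map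
    \<Rightarrow> 'v \<Rightarrow> 'v \<Rightarrow> 'w \<Rightarrow> bool" where
  "jacobi_identity scaleW Y YW u v w \<longleftrightarrow>
     (\<lambda>e. series_mult scaleW delta_12_0 (prod_12 YW u v w) e
          - series_mult scaleW delta_21_0 (prod_21 YW u v w) e)
     = series_mult scaleW delta_20_1 (iterate_02 Y YW u v w)"

text \<open>A linear map \<open>V \<rightarrow> (End W)[[x,x\<^sup>-\<^sup>1]]\<close> with \<open>Y\<^sub>W(u,x)w \<in> W((x))\<close>.\<close>

locale truncated_vertex_map =
  V: vector_space scaleV + W: vector_space scaleW
  for scaleV :: "complex \<Rightarrow> 'v::ab_group_add \<Rightarrow> 'v"
    and scaleW :: "complex \<Rightarrow> 'w::ab_group_add \<Rightarrow> 'w" +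
  fixes YW :: "('v, 'w) vertex_map"
  assumes coeff_endomorphism: "Vector_Spaces.linear scaleW scaleW (YW v n)"
    and linear_in_vector: "Vector_Spaces.linear scaleV scaleW (\<lambda>v. YW v n w)"
    and truncation: "\<exists>N. \<forall>n<N. YW u n w = 0"

locale vacuum_free_vertex_algebra =
  truncated_vertex_map scaleV scaleV Y
  for scaleV :: "complex \<Rightarrow> 'v::ab_group_add \<Rightarrow> 'v"
    and Y :: "('v, 'v) vertex_map" +
  assumes injective: "inj Y"
    and jacobi: "jacobi_identity scaleV Y Y u v w"

text \<open>\<open>A(x\<^sub>0 + x\<^sub>2) = (\<Sum>n. A\<^sub>n (x\<^sub>0 + x\<^sub>2)\<^sup>n)\<close> for an operator-valued series \<open>A(x)\<close>.\<close>

definition subst_x0_plus_x2 ::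
  "(complex \<Rightarrow> 'w \<Rightarrow> 'w) \<Rightarrow> (int \<Rightarrow> 'w \<Rightarrow> 'w::comm_monoid_add) \<Rightarrow> int \<times> int \<Rightarrow> 'w \<Rightarrow> 'w" where
  "subst_x0_plus_x2 scaleW A =
     (\<lambda>(a, b) w. Sum_any (\<lambda>n. scaleW (binom_pow 1 1 n a b) (A n w)))"

text \<open>
  \<open>F(x\<^sub>0, x\<^sub>2 + x\<^sub>0) = (\<Sum>i j. F\<^sub>i\<^sub>j x\<^sub>0\<^sup>i (x\<^sub>2 + x\<^sub>0)\<^sup>j)\<close>, expanded in nonnegative powers of \<open>x\<^sub>0\<close>, for an
  operator-valued series \<open>F(x\<^sub>0, x\<^sub>2)\<close>.
\<close>

definition subst_x2_plus_x0 ::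
  "(complex \<Rightarrow> 'w \<Rightarrow> 'w) \<Rightarrow> (int \<times> int \<Rightarrow> 'w \<Rightarrow> 'w::comm_monoid_add) \<Rightarrow> int \<times> int \<Rightarrow> 'w \<Rightarrow> 'w" where
  "subst_x2_plus_x0 scaleW F =
     (\<lambda>(a, b) w. Sum_any (\<lambda>(i, j). scaleW (binom_pow 1 1 j b (a - i)) (F (i, j) w)))"

text \<open>\<open>F(- x\<^sub>0, x\<^sub>2)\<close>.\<close>

definition negate_x0 ::
  "(complex \<Rightarrow> 'w \<Rightarrow> 'w) \<Rightarrow> (int \<times> int \<Rightarrow> 'w \<Rightarrow> 'w) \<Rightarrow> int \<times> int \<Rightarrow> 'w \<Rightarrow> 'w" where
  "negate_x0 scaleW F = (\<lambda>(i, j) w. scaleW ((- 1) powi i) (F (i, j) w))"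

text \<open>\<open>Y\<^sub>W(Y(u,x\<^sub>0)v,x\<^sub>2)\<close>.\<close>

definition iterate ::
  "('v, 'v) vertex_map \<Rightarrow> ('v, 'w) vertex_map \<Rightarrow> 'v \<Rightarrow> 'v \<Rightarrow> int \<times> int \<Rightarrow> 'w \<Rightarrow> 'w" where
  "iterate Y YW u v = (\<lambda>(i, j). YW (Y u i v) j)"

text \<open>\<open>Y\<^sub>W(u,x\<^sub>0 + x\<^sub>2) Y\<^sub>W(v,x\<^sub>2) w\<close>.\<close>

definition assoc_product ::
  "(complex \<Rightarrow> 'w \<Rightarrow> 'w) \<Rightarrow> ('v, 'w::comm_monoid_add) vertex_map \<Rightarrow> 'v \<Rightarrow> 'v \<Rightarrow> 'w \<Rightarrow> int \<times> int \<Rightarrow> 'w" where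
  "assoc_product scaleW YW u v w =
     series_mult (\<lambda>f. f) (subst_x0_plus_x2 scaleW (YW u)) (\<lambda>(i, j). if i = 0 then YW v j w else 0)"

definition weak_associativity ::
  "(complex \<Rightarrow> 'w \<Rightarrow> 'w) \<Rightarrow> ('v, 'v) vertex_map \<Rightarrow> ('v, 'w::ab_group_add) vertex_map
    \<Rightarrow> 'v \<Rightarrow> 'v \<Rightarrow> 'w \<Rightarrow> bool" where
  "weak_associativity scaleW Y YW u v w \<longleftrightarrow>
     (\<exists>m::nat. series_mult scaleW (\<lambda>(i, j). binom_pow 1 1 (int m) i j)
        (\<lambda>e. assoc_product scaleW YW u v w e - iterate Y YW u v e w) = (\<lambda>_. 0))"

definition vacuum_free_skew_symmetry ::
  "(complex \<Rightarrow> 'w \<Rightarrow> 'w) \<Rightarrow> ('v, 'v) vertex_map \<Rightarrow> ('v, 'w::comm_monoid_add) vertex_map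
    \<Rightarrow> 'v \<Rightarrow> 'v \<Rightarrow> bool" where
  "vacuum_free_skew_symmetry scaleW Y YW u v \<longleftrightarrow>
     iterate Y YW u v = subst_x2_plus_x0 scaleW (negate_x0 scaleW (iterate Y YW v u))"

end

theory Submission
  imports Defs
begin

text \<open>
  The coefficient of \<open>x\<^sub>0\<^sup>a x\<^sub>1\<^sup>b x\<^sub>2\<^sup>c\<close> in each of the three terms of the Jacobi identity is a residue
  of the corresponding vertex operator series against \<open>x\<^sub>0\<^sup>-\<^sup>a\<^sup>-\<^sup>1 x\<^sub>1\<^sup>-\<^sup>b\<^sup>-\<^sup>1 x\<^sub>2\<^sup>-\<^sup>c\<^sup>-\<^sup>1\<close>, in which the delta
  function imposes \<open>x\<^sub>0 = x\<^sub>1 - x\<^sub>2\<close>, with a different expansion in each term. Multiplying the test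
  monomial by \<open>x\<^sub>0 = x\<^sub>1 - x\<^sub>2\<close> shows that each term, hence also the defect \<open>J\<close> of the Jacobi
  identity, satisfies
  \<open>F (a - 1) b c = F a (b - 1) c - F a b (c - 1)\<close>; on coefficients this is Pascal's rule.

  The recurrence makes such a family rigid: if it vanishes in one plane \<open>b = b\<^sub>0\<close>, then it vanishes
  for all \<open>b \<le> b\<^sub>0\<close>; and if it vanishes both for all \<open>b \<le> b\<^sub>0\<close> and for all \<open>c \<le> c\<^sub>0\<close>, then it vanishes
  identically (\<open>difference_recurrence_unique\<close>). The two axioms are statements about single planes.

  \<^item> Multiplication by \<open>(x\<^sub>0 + x\<^sub>2)\<^sup>m\<close> moves the plane \<open>b = -1\<close> to the plane \<open>b = -1 - m\<close>. Weak
    associativity therefore says that the product term \<open>Y\<^sub>W(u,x\<^sub>1)Y\<^sub>W(v,x\<^sub>2)w\<close> and the iterate term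
    agree for some \<open>b = -1 - m\<close>. For very negative \<open>b\<close> the opposite product vanishes by
    truncation, so weak associativity amounts to \<open>J = 0\<close> for all sufficiently negative \<open>b\<close>.

  \<^item> Exchanging \<open>(u, x\<^sub>1)\<close> with \<open>(v, x\<^sub>2)\<close> and \<open>x\<^sub>0\<close> with \<open>-x\<^sub>0\<close> exchanges the two product terms, so the
    defects for \<open>(u,v)\<close> and \<open>(v,u)\<close> differ by the failure \<open>E\<close> of the iterate term to have the
    same symmetry. Skew symmetry is \<open>E = 0\<close> in the plane \<open>b = -1\<close>. Truncation of \<open>Y(u,x\<^sub>0)v\<close> and
    \<open>Y(v,x\<^sub>0)u\<close> gives \<open>E = 0\<close> for very negative \<open>a\<close>, and rigidity, applied with the roles of \<open>a\<close> and
    \<open>c\<close> exchanged, turns \<open>E = 0\<close> in one plane into \<open>E = 0\<close> everywhere.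

  The Jacobi identity thus gives both axioms at once. Conversely, weak associativity for \<open>(u,v)\<close>
  gives \<open>J = 0\<close> for very negative \<open>b\<close>; weak associativity for \<open>(v,u)\<close>, carried over by skew symmetry,
  gives \<open>J = 0\<close> for very negative \<open>c\<close>; and rigidity gives \<open>J = 0\<close>.
\<close>

section \<open>Families of coefficients governed by \<open>x\<^sub>0 = x\<^sub>1 - x\<^sub>2\<close>\<close>

definition difference_recurrence :: "(int \<Rightarrow> int \<Rightarrow> int \<Rightarrow> 'w::ab_group_add) \<Rightarrow> bool" where
  "difference_recurrence F \<longleftrightarrow> (\<forall>a b c. F (a - 1) b c = F a (b - 1) c - F a b (c - 1))"

lemma difference_recurrenceD:
  "difference_recurrence F \<Longrightarrow> F a (b - 1) c = F (a - 1) b c + F a b (c - 1)"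
  by (simp add: difference_recurrence_def)

lemma difference_recurrence_diff:
  assumes "difference_recurrence F" "difference_recurrence G"
  shows "difference_recurrence (\<lambda>a b c. F a b c - G a b c)"
  using assms by (simp add: difference_recurrence_def algebra_simps)

text \<open>The relation \<open>x\<^sub>1 = x\<^sub>0 + x\<^sub>2\<close> is symmetric in \<open>x\<^sub>0\<close> and \<open>x\<^sub>2\<close>.\<close>

lemma difference_recurrence_swap_02:
  "difference_recurrence F \<Longrightarrow> difference_recurrence (\<lambda>a b c. F c b a)"
  by (simp add: difference_recurrence_def algebra_simps)

lemma difference_recurrence_zero_below:
  assumes "difference_recurrence F" "\<And>a c. F a b0 c = 0" "b \<le> b0"
  shows "F a b c = 0"
  using assms(3)
proof (induction b arbitrary: a c rule: int_le_induct)
  case base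
  show ?case by (rule assms(2))
next
  case (step b)
  then show ?case using difference_recurrenceD[OF assms(1), of a b c] by simp
qed

text \<open>
  Induction on \<open>c\<close>: once the family vanishes in the plane \<open>c\<close>, the recurrence says that in the plane
  \<open>c + 1\<close> its value is unchanged when \<open>a\<close> increases and \<open>b\<close> decreases by one, and this leads into the
  region \<open>b \<le> b\<^sub>0\<close>.
\<close>

lemma difference_recurrence_unique:
  assumes F: "difference_recurrence F"
    and b0: "\<And>a b c. b \<le> b0 \<Longrightarrow> F a b c = 0"
    and c0: "\<And>a b c. c \<le> c0 \<Longrightarrow> F a b c = 0"
  shows "F a b c = 0"
proof -
  have next_c: "F a b (c + 1) = 0" if c: "\<And>a b. F a b c = 0" for a b c
  proof (cases "b \<le> b0")
    case False
    then have "b0 \<le> b" by simp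
    then show ?thesis
    proof (induction b arbitrary: a rule: int_ge_induct)
      case base
      show ?case by (simp add: b0)
    next
      case (step b)
      then show ?case
        using difference_recurrenceD[OF F, of "a + 1" "b + 1" "c + 1"] c by simp
    qed
  qed (simp add: b0)
  show ?thesis
  proof (cases "c \<le> c0")
    case False
    then have "c0 \<le> c" by simp
    then show ?thesis
      by (induction c arbitrary: a b rule: int_ge_induct) (simp_all add: c0 next_c)
  qed (simp add: c0)
qed

section \<open>Binomial sums\<close>

text \<open>
  Every coefficient sum over exponent tuples is supported on the ray of exponents of a single
  binomial expansion; this turns it into a sum over \<open>k :: nat\<close>. The supports of the two sums
  correspond bijectively, so that either both sums are finite or both take the default value 0.
\<close>

lemma Sum_any_reindex:
  assumes "inj h" "\<And>d. d \<notin> range h \<Longrightarrow> F d = 0"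
  shows "Sum_any F = Sum_any (\<lambda>k. F (h k))"
proof -
  have "{d. F d \<noteq> 0} = h ` {k. F (h k) \<noteq> 0}"
    using assms(2) by (auto simp: image_iff) metis
  moreover have "inj_on h {k. F (h k) \<noteq> 0}" using assms(1) by (auto simp: inj_on_def)
  ultimately show ?thesis by (simp add: Sum_any.expand_set sum.reindex)
qed

text \<open>
  \<open>(1 + S)\<^sup>n\<close> applied to \<open>g\<close> and evaluated at 0, where \<open>S\<close> is the shift of sequences and \<open>n\<close> may be
  negative.
\<close>

definition newton_sum :: "(complex \<Rightarrow> 'w \<Rightarrow> 'w) \<Rightarrow> int \<Rightarrow> (nat \<Rightarrow> 'w::comm_monoid_add) \<Rightarrow> 'w" where
  "newton_sum scale n g = Sum_any (\<lambda>k. scale (of_int n gchoose k) (g k))"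

locale complex_vector_space = vector_space scale
  for scale :: "complex \<Rightarrow> 'w::ab_group_add \<Rightarrow> 'w"
begin

text \<open>
  \<open>(1 + S)\<^sup>n\<^sup>+\<^sup>1 = (1 + S)\<^sup>n + (1 + S)\<^sup>n S\<close>. The finiteness conditions hold for two different reasons:
  for truncated series because \<open>g\<close> is eventually zero, and for natural \<open>n\<close> because the binomial
  coefficients are, even when \<open>g\<close> has infinite support.
\<close>

lemma newton_sum_pascal:
  assumes "finite {k. scale (of_int n gchoose k) (g k) \<noteq> 0}"
    and "finite {k. scale (of_int n gchoose k) (g (Suc k)) \<noteq> 0}"
  shows "newton_sum scale (n + 1) g = newton_sum scale n g + newton_sum scale n (\<lambda>k. g (Suc k))"
proof -
  let ?f = "\<lambda>k. case k of 0 \<Rightarrow> 0 | Suc j \<Rightarrow> scale (of_int n gchoose j) (g (Suc j))"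
  have "{k. ?f k \<noteq> 0} \<subseteq> Suc ` {k. scale (of_int n gchoose k) (g (Suc k)) \<noteq> 0}"
  proof
    fix k assume "k \<in> {k. ?f k \<noteq> 0}"
    then show "k \<in> Suc ` {k. scale (of_int n gchoose k) (g (Suc k)) \<noteq> 0}"
      by (cases k) simp_all
  qed
  then have fin: "finite {k. ?f k \<noteq> 0}" using assms(2) finite_subset by blast
  have "scale (of_int (n + 1) gchoose k) (g k) = scale (of_int n gchoose k) (g k) + ?f k" for k
    by (cases k) (auto simp: gbinomial_Suc_Suc scale_left_distrib intro: add.commute)
  then have "newton_sum scale (n + 1) g = newton_sum scale n g + Sum_any ?f"
    unfolding newton_sum_def by (simp add: Sum_any.distrib[OF assms(1) fin])
  also have "Sum_any ?f = newton_sum scale n (\<lambda>k. g (Suc k))"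
    unfolding newton_sum_def
    by (subst Sum_any_reindex[of Suc]) (auto split: nat.splits simp: image_iff)
  finally show ?thesis .
qed

lemma newton_sum_pascal_truncated:
  assumes "\<And>k. K \<le> k \<Longrightarrow> g k = 0"
  shows "newton_sum scale (n + 1) g = newton_sum scale n g + newton_sum scale n (\<lambda>k. g (Suc k))"
proof (rule newton_sum_pascal)
  have "{k. scale (of_int n gchoose k) (g k) \<noteq> 0} \<subseteq> {..<K}"
    "{k. scale (of_int n gchoose k) (g (Suc k)) \<noteq> 0} \<subseteq> {..<K}"
    using assms by (force simp: not_le[symmetric])+
  then show "finite {k. scale (of_int n gchoose k) (g k) \<noteq> 0}"
    "finite {k. scale (of_int n gchoose k) (g (Suc k)) \<noteq> 0}"
    using finite_subset by blast+
qed

lemma newton_sum_pascal_nat: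
  "newton_sum scale (int m + 1) g
     = newton_sum scale (int m) g + newton_sum scale (int m) (\<lambda>k. g (Suc k))"
proof (rule newton_sum_pascal)
  have "{k. scale (of_int (int m) gchoose k) (f k) \<noteq> 0} \<subseteq> {..m}" for f :: "nat \<Rightarrow> 'w"
    by (auto simp: binomial_gbinomial[symmetric] not_le[symmetric] intro: ccontr)
  then show "finite {k. scale (of_int (int m) gchoose k) (g k) \<noteq> 0}"
    "finite {k. scale (of_int (int m) gchoose k) (g (Suc k)) \<noteq> 0}"
    by (rule finite_subset[OF _ finite_atMost])+
qed

lemma newton_sum_0: "newton_sum scale 0 g = g 0"
proof -
  have "newton_sum scale 0 g = Sum_any (\<lambda>k. if k = 0 then g k else 0)"
    unfolding newton_sum_def by (intro Sum_any.cong) (auto simp: gbinomial_0_left)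
  then show ?thesis by simp
qed

lemma scale_Sum_any:
  assumes "s \<noteq> 0"
  shows "scale s (Sum_any f) = Sum_any (\<lambda>k. scale s (f k))"
  using assms by (simp add: Sum_any.expand_set scale_sum_right)

text \<open>
  The left-hand side is a coefficient of \<open>(x\<^sub>0 + x\<^sub>2)\<^sup>m\<close> times the series with coefficients \<open>F _ b _\<close>;
  since \<open>x\<^sub>0 + x\<^sub>2 = x\<^sub>1\<close>, this factor just shifts \<open>b\<close>.
\<close>

lemma difference_recurrence_binomial_expansion:
  assumes "difference_recurrence F"
  shows "newton_sum scale (int m) (\<lambda>k. F (a - int m + int k) b (c - int k)) = F a (b - int m) c"
proof (induction m arbitrary: a c)
  case 0
  show ?case by (simp add: newton_sum_0)
next
  case (Suc m)
  have "newton_sum scale (int (Suc m)) (\<lambda>k. F (a - int (Suc m) + int k) b (c - int k))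
      = newton_sum scale (int m) (\<lambda>k. F ((a - 1) - int m + int k) b (c - int k))
        + newton_sum scale (int m) (\<lambda>k. F (a - int m + int k) b ((c - 1) - int k))"
    using newton_sum_pascal_nat[of m "\<lambda>k. F (a - int (Suc m) + int k) b (c - int k)"]
    by (simp add: algebra_simps)
  also have "\<dots> = F (a - 1) (b - int m) c + F a (b - int m) (c - 1)"
    by (simp only: Suc.IH)
  also have "\<dots> = F a (b - int (Suc m)) c"
    using difference_recurrenceD[OF assms, of a "b - int m" c] by (simp add: algebra_simps)
  finally show ?case .
qed

text \<open>The relation \<open>x\<^sub>0 = x\<^sub>1 - x\<^sub>2\<close> is preserved by exchanging \<open>x\<^sub>1\<close> with \<open>x\<^sub>2\<close> and negating \<open>x\<^sub>0\<close>.\<close>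

lemma difference_recurrence_swap_12:
  assumes "difference_recurrence F"
  shows "difference_recurrence (\<lambda>a b c. scale ((- 1) powi a) (F a c b))"
  unfolding difference_recurrence_def
proof (intro allI)
  fix a b c
  have "(- 1 :: complex) powi (a - 1) = - ((- 1) powi a)"
    by (simp add: power_int_diff)
  moreover have "F (a - 1) c b = F a (c - 1) b - F a c (b - 1)"
    using assms by (simp add: difference_recurrence_def)
  ultimately show "scale ((- 1) powi (a - 1)) (F (a - 1) c b)
      = scale ((- 1) powi a) (F a c (b - 1)) - scale ((- 1) powi a) (F a (c - 1) b)"
    by (simp add: scale_right_diff_distrib)
qed

end

section \<open>Coefficients of the product and the iterate\<close>

locale vertex_map_pair =
  YW: truncated_vertex_map scaleV scaleW YW + Y: truncated_vertex_map scaleV scaleV Y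
  for scaleV :: "complex \<Rightarrow> 'v::ab_group_add \<Rightarrow> 'v"
    and scaleW :: "complex \<Rightarrow> 'w::ab_group_add \<Rightarrow> 'w"
    and Y :: "('v, 'v) vertex_map"
    and YW :: "('v, 'w) vertex_map"
begin

sublocale W: complex_vector_space scaleW ..

text \<open>
  The coefficient of \<open>x\<^sub>0\<^sup>a x\<^sub>1\<^sup>b x\<^sub>2\<^sup>c\<close> in \<open>x\<^sub>0\<^sup>-\<^sup>1 \<delta>((x\<^sub>1 - x\<^sub>2)/x\<^sub>0) Y\<^sub>W(u,x\<^sub>1) Y\<^sub>W(v,x\<^sub>2) w\<close>. The second term of
  the Jacobi identity is expressed through it as well, with \<open>u\<close> and \<open>v\<close> exchanged.
\<close>

definition product_coeff :: "'v \<Rightarrow> 'v \<Rightarrow> 'w \<Rightarrow> int \<Rightarrow> int \<Rightarrow> int \<Rightarrow> 'w" where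
  "product_coeff u v w a b c = newton_sum scaleW (- a - 1)
     (\<lambda>k. scaleW ((- 1) ^ k) (YW u (a + b + 1 + int k) (YW v (c - int k) w)))"

text \<open>The coefficient of \<open>x\<^sub>0\<^sup>a x\<^sub>1\<^sup>b x\<^sub>2\<^sup>c\<close> in \<open>x\<^sub>1\<^sup>-\<^sup>1 \<delta>((x\<^sub>2 + x\<^sub>0)/x\<^sub>1) Y\<^sub>W(Y(u,x\<^sub>0)v,x\<^sub>2) w\<close>.\<close>

definition iterate_coeff :: "'v \<Rightarrow> 'v \<Rightarrow> 'w \<Rightarrow> int \<Rightarrow> int \<Rightarrow> int \<Rightarrow> 'w" where
  "iterate_coeff u v w a b c = newton_sum scaleW (- b - 1)
     (\<lambda>k. YW (Y u (a - int k) v) (b + c + 1 + int k) w)"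

lemma YW_zero_right: "YW u n 0 = 0"
  using YW.coeff_endomorphism[of u n] by (simp add: linear_iff_module_hom module_hom.zero)

lemma YW_zero_left: "YW 0 n w = 0"
  using module_hom.zero[OF YW.linear_in_vector[unfolded linear_iff_module_hom]] .

lemma difference_recurrence_product: "difference_recurrence (product_coeff u v w)"
  unfolding difference_recurrence_def
proof (intro allI)
  fix a b c
  let ?g = "\<lambda>k. scaleW ((- 1) ^ k) (YW u (a + b + int k) (YW v (c - int k) w))"
  obtain N where N: "\<And>n. n < N \<Longrightarrow> YW v n w = 0"
    using YW.truncation by blast
  have "?g k = 0" if "nat (c - N + 1) \<le> k" for k
    using that N[of "c - int k"] by (simp add: YW_zero_right)
  then have "newton_sum scaleW (- a - 1 + 1) ?g
      = newton_sum scaleW (- a - 1) ?g + newton_sum scaleW (- a - 1) (\<lambda>k. ?g (Suc k))"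
    by (rule W.newton_sum_pascal_truncated)
  moreover have "newton_sum scaleW (- a - 1) (\<lambda>k. ?g (Suc k)) = - product_coeff u v w a b (c - 1)"
  proof -
    have "?g (Suc k) = scaleW (- 1)
        (scaleW ((- 1) ^ k) (YW u (a + b + 1 + int k) (YW v (c - 1 - int k) w)))" for k
      by (simp add: algebra_simps)
    then have "newton_sum scaleW (- a - 1) (\<lambda>k. ?g (Suc k))
        = scaleW (- 1) (product_coeff u v w a b (c - 1))"
      unfolding product_coeff_def newton_sum_def
      by (subst W.scale_Sum_any) (simp_all add: mult.commute)
    then show ?thesis by simp
  qed
  ultimately show "product_coeff u v w (a - 1) b c
      = product_coeff u v w a (b - 1) c - product_coeff u v w a b (c - 1)"
    by (simp add: product_coeff_def)
qed

lemma difference_recurrence_iterate: "difference_recurrence (iterate_coeff u v w)"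
  unfolding difference_recurrence_def
proof (intro allI)
  fix a b c
  let ?g = "\<lambda>k. YW (Y u (a - int k) v) (b + c + int k) w"
  obtain N where N: "\<And>n. n < N \<Longrightarrow> Y u n v = 0"
    using Y.truncation by blast
  have "?g k = 0" if "nat (a - N + 1) \<le> k" for k
    using that N[of "a - int k"] by (simp add: YW_zero_left)
  then have "newton_sum scaleW (- b - 1 + 1) ?g
      = newton_sum scaleW (- b - 1) ?g + newton_sum scaleW (- b - 1) (\<lambda>k. ?g (Suc k))"
    by (rule W.newton_sum_pascal_truncated)
  then show "iterate_coeff u v w (a - 1) b c
      = iterate_coeff u v w a (b - 1) c - iterate_coeff u v w a b (c - 1)"
    by (simp add: iterate_coeff_def algebra_simps)
qed

text \<open>
  All powers of \<open>x\<^sub>2\<close> applied to \<open>w\<close> in the coefficient at \<open>(a, b, c)\<close> are at most \<open>c\<close>, so the bound is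
  uniform in \<open>a\<close> and \<open>b\<close>.
\<close>

lemma product_coeff_eventually_zero: "\<exists>N. \<forall>a b c. c \<le> N \<longrightarrow> product_coeff u v w a b c = 0"
proof -
  obtain N where N: "\<And>n. n < N \<Longrightarrow> YW v n w = 0"
    using YW.truncation by blast
  have "product_coeff u v w a b c = 0" if "c \<le> N - 1" for a b c
    using that by (simp add: product_coeff_def newton_sum_def N YW_zero_right)
  then show ?thesis by blast
qed

lemma iterate_coeff_eventually_zero: "\<exists>N. \<forall>a b c. a \<le> N \<longrightarrow> iterate_coeff u v w a b c = 0"
proof -
  obtain N where N: "\<And>n. n < N \<Longrightarrow> Y u n v = 0"
    using Y.truncation by blast
  have "iterate_coeff u v w a b c = 0" if "a \<le> N - 1" for a b c
    using that by (simp add: iterate_coeff_def newton_sum_def N YW_zero_left)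
  then show ?thesis by blast
qed

text \<open>In the plane \<open>b = -1\<close> the delta function contributes only its constant term.\<close>

lemma iterate_coeff_minus_one: "iterate_coeff u v w a (- 1) c = YW (Y u a v) c w"
  by (simp add: iterate_coeff_def W.newton_sum_0)

section \<open>The Jacobi identity in coefficients\<close>

lemma series_mult_delta_12:
  "series_mult scaleW delta_12_0 (prod_12 YW u v w) (a, b, c) = product_coeff u v w a b c"
  unfolding series_mult_def product_coeff_def newton_sum_def
proof (subst Sum_any_reindex[where h = "\<lambda>k. (a, - a - 1 - int k, int k)"])
  show "inj (\<lambda>k. (a, - a - 1 - int k, int k))" by (simp add: inj_on_def)
next
  fix d :: "int \<times> int \<times> int"
  assume d: "d \<notin> range (\<lambda>k. (a, - a - 1 - int k, int k))"
  obtain i j k where ijk: "d = (i, j, k)" by (cases d) auto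
  have "i \<noteq> a \<or> k < 0 \<or> j + k \<noteq> - a - 1"
    using d ijk by (auto simp: image_iff) (metis add_diff_cancel nonneg_int_cases not_le)
  then show "scaleW (delta_12_0 d) (prod_12 YW u v w ((a, b, c) - d)) = 0"
    by (auto simp: ijk delta_12_0_def prod_12_def delta_quot_def binom_pow_def)
next
  show "Sum_any (\<lambda>k. scaleW (delta_12_0 (a, - a - 1 - int k, int k))
        (prod_12 YW u v w ((a, b, c) - (a, - a - 1 - int k, int k))))
      = Sum_any (\<lambda>k. scaleW (of_int (- a - 1) gchoose k)
        (scaleW ((- 1) ^ k) (YW u (a + b + 1 + int k) (YW v (c - int k) w))))"
    by (intro Sum_any.cong)
      (simp add: delta_12_0_def prod_12_def delta_quot_def binom_pow_def formal_delta_def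
        algebra_simps)
qed

text \<open>
  Exchanging \<open>(u, x\<^sub>1)\<close> with \<open>(v, x\<^sub>2)\<close> and replacing \<open>x\<^sub>0\<close> by \<open>-x\<^sub>0\<close> carries the first delta function into
  the second one; the overall sign comes from the factor \<open>x\<^sub>0\<^sup>-\<^sup>1\<close>.
\<close>

lemma series_mult_delta_21:
  "series_mult scaleW delta_21_0 (prod_21 YW u v w) (a, b, c)
     = - scaleW ((- 1) powi a) (product_coeff v u w a c b)"
proof -
  have sign: "(- 1 :: complex) powi (- a - 1 - int k) = - ((- 1) powi a) * (- 1) ^ k" for k
    by (simp add: power_int_diff power_int_minus power_int_add field_simps)
  have "series_mult scaleW delta_21_0 (prod_21 YW u v w) (a, b, c)
      = Sum_any (\<lambda>k. scaleW (delta_21_0 (a, int k, - a - 1 - int k))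
          (prod_21 YW u v w ((a, b, c) - (a, int k, - a - 1 - int k))))"
    unfolding series_mult_def
  proof (rule Sum_any_reindex)
    show "inj (\<lambda>k. (a, int k, - a - 1 - int k))" by (simp add: inj_on_def)
  next
    fix d :: "int \<times> int \<times> int"
    assume d: "d \<notin> range (\<lambda>k. (a, int k, - a - 1 - int k))"
    obtain i j k where ijk: "d = (i, j, k)" by (cases d) auto
    have "i \<noteq> a \<or> j < 0 \<or> k + j \<noteq> - a - 1"
      using d ijk by (auto simp: image_iff) (metis add_diff_cancel nonneg_int_cases not_le)
    then show "scaleW (delta_21_0 d) (prod_21 YW u v w ((a, b, c) - d)) = 0"
      by (auto simp: ijk delta_21_0_def prod_21_def delta_quot_def binom_pow_def)
  qed
  also have "\<dots> = Sum_any (\<lambda>k. scaleW (- ((- 1) powi a)) (scaleW (of_int (- a - 1) gchoose k)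
        (scaleW ((- 1) ^ k) (YW v (a + c + 1 + int k) (YW u (b - int k) w)))))"
    by (intro Sum_any.cong)
      (simp add: delta_21_0_def prod_21_def delta_quot_def binom_pow_def formal_delta_def
        sign[unfolded diff_diff_eq] algebra_simps)
  also have "\<dots> = scaleW (- ((- 1) powi a)) (product_coeff v u w a c b)"
    unfolding product_coeff_def newton_sum_def by (rule W.scale_Sum_any[symmetric]) simp
  finally show ?thesis by simp
qed

lemma series_mult_delta_20:
  "series_mult scaleW delta_20_1 (iterate_02 Y YW u v w) (a, b, c) = iterate_coeff u v w a b c"
  unfolding series_mult_def iterate_coeff_def newton_sum_def
proof (subst Sum_any_reindex[where h = "\<lambda>k. (int k, b, - b - 1 - int k)"])
  show "inj (\<lambda>k. (int k, b, - b - 1 - int k))" by (simp add: inj_on_def)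
next
  fix d :: "int \<times> int \<times> int"
  assume d: "d \<notin> range (\<lambda>k. (int k, b, - b - 1 - int k))"
  obtain i j k where ijk: "d = (i, j, k)" by (cases d) auto
  have "j \<noteq> b \<or> i < 0 \<or> k + i \<noteq> - b - 1"
    using d ijk by (auto simp: image_iff) (metis add_diff_cancel nonneg_int_cases not_le)
  then show "scaleW (delta_20_1 d) (iterate_02 Y YW u v w ((a, b, c) - d)) = 0"
    by (auto simp: ijk delta_20_1_def iterate_02_def delta_quot_def binom_pow_def)
next
  show "Sum_any (\<lambda>k. scaleW (delta_20_1 (int k, b, - b - 1 - int k))
        (iterate_02 Y YW u v w ((a, b, c) - (int k, b, - b - 1 - int k))))
      = Sum_any (\<lambda>k. scaleW (of_int (- b - 1) gchoose k)
        (YW (Y u (a - int k) v) (b + c + 1 + int k) w))"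
    by (intro Sum_any.cong)
      (simp add: delta_20_1_def iterate_02_def delta_quot_def binom_pow_def formal_delta_def
        algebra_simps)
qed

definition jacobi_defect :: "'v \<Rightarrow> 'v \<Rightarrow> 'w \<Rightarrow> int \<Rightarrow> int \<Rightarrow> int \<Rightarrow> 'w" where
  "jacobi_defect u v w a b c = product_coeff u v w a b c - iterate_coeff u v w a b c
     + scaleW ((- 1) powi a) (product_coeff v u w a c b)"

lemma jacobi_identity_iff:
  "jacobi_identity scaleW Y YW u v w \<longleftrightarrow> (\<forall>a b c. jacobi_defect u v w a b c = 0)"
  unfolding jacobi_identity_def fun_eq_iff split_paired_All series_mult_delta_12
    series_mult_delta_21 series_mult_delta_20 jacobi_defect_def
  by (simp add: algebra_simps)

lemma difference_recurrence_jacobi_defect: "difference_recurrence (jacobi_defect u v w)"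
proof -
  have "jacobi_defect u v w = (\<lambda>a b c. (product_coeff u v w a b c - iterate_coeff u v w a b c)
     - (0 - scaleW ((- 1) powi a) (product_coeff v u w a c b)))"
    by (simp add: jacobi_defect_def fun_eq_iff)
  moreover have "difference_recurrence (\<lambda>_ _ _. 0 :: 'w)" by (simp add: difference_recurrence_def)
  ultimately show ?thesis
    by (simp add: difference_recurrence_diff W.difference_recurrence_swap_12
      difference_recurrence_product difference_recurrence_iterate del: diff_0 diff_minus_eq_add)
qed

section \<open>Weak associativity in coefficients\<close>

text \<open>
  This identity matches the binomials of substituted powers \<open>(x + y)\<^sup>n\<close>, whose upper index varies
  with \<open>k\<close>, with those of the delta functions, whose upper index does not.
\<close>

lemma gbinomial_upper_reflect:
  "(of_int (a + int k) :: complex) gchoose k = (- 1) ^ k * (of_int (- a - 1) gchoose k)"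
  using gbinomial_negated_upper[of "of_int (a + int k) :: complex" k] by (simp add: algebra_simps)

lemma subst_x0_plus_x2_eq:
  "subst_x0_plus_x2 scaleW A (i, j) z
     = (if 0 \<le> j then scaleW (of_int (i + j) gchoose nat j) (A (i + j) z) else 0)"
proof -
  have "Sum_any (\<lambda>n. scaleW (binom_pow 1 1 n i j) (A n z)) = Sum_any (\<lambda>n. if n = i + j
      then if 0 \<le> j then scaleW (of_int n gchoose nat j) (A n z) else 0 else 0)"
    by (rule arg_cong[where f = Sum_any]) (auto simp: fun_eq_iff binom_pow_def)
  then show ?thesis by (simp add: subst_x0_plus_x2_def)
qed

lemma assoc_product_eq: "assoc_product scaleW YW u v w (a, c) = product_coeff u v w a (- 1) c"
  unfolding assoc_product_def series_mult_def product_coeff_def newton_sum_def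
proof (subst Sum_any_reindex[where h = "\<lambda>k. (a, int k)"])
  show "inj (\<lambda>k. (a, int k))" by (simp add: inj_on_def)
next
  fix d :: "int \<times> int"
  assume d: "d \<notin> range (\<lambda>k. (a, int k))"
  obtain i j where ij: "d = (i, j)" by (cases d) auto
  have "i \<noteq> a \<or> j < 0"
    using d ij by (auto simp: image_iff) (metis nonneg_int_cases not_le)
  then show "subst_x0_plus_x2 scaleW (YW u) d
      (case (a, c) - d of (i, j) \<Rightarrow> if i = 0 then YW v j w else 0) = 0"
    by (auto simp: ij subst_x0_plus_x2_eq YW_zero_right)
next
  show "Sum_any (\<lambda>k. subst_x0_plus_x2 scaleW (YW u) (a, int k)
        (case (a, c) - (a, int k) of (i, j) \<Rightarrow> if i = 0 then YW v j w else 0))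
      = Sum_any (\<lambda>k. scaleW (of_int (- a - 1) gchoose k)
        (scaleW ((- 1) ^ k) (YW u (a + - 1 + 1 + int k) (YW v (c - int k) w))))"
    by (intro Sum_any.cong)
      (simp add: subst_x0_plus_x2_eq gbinomial_upper_reflect[simplified] mult.commute)
qed

lemma series_mult_binom_pow:
  "series_mult scaleW (\<lambda>(i, j). binom_pow 1 1 (int m) i j) B (a, c)
     = newton_sum scaleW (int m) (\<lambda>k. B (a - int m + int k, c - int k))"
  unfolding series_mult_def newton_sum_def
proof (subst Sum_any_reindex[where h = "\<lambda>k. (int m - int k, int k)"])
  show "inj (\<lambda>k. (int m - int k, int k))" by (simp add: inj_on_def)
next
  fix d :: "int \<times> int"
  assume d: "d \<notin> range (\<lambda>k. (int m - int k, int k))"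
  obtain i j where ij: "d = (i, j)" by (cases d) auto
  have "j < 0 \<or> i + j \<noteq> int m"
    using d ij by (auto simp: image_iff) (metis add_diff_cancel nonneg_int_cases not_le)
  then show "scaleW (case d of (i, j) \<Rightarrow> binom_pow 1 1 (int m) i j) (B ((a, c) - d)) = 0"
    by (auto simp: ij binom_pow_def)
next
  show "Sum_any (\<lambda>k. scaleW (case (int m - int k, int k) of (i, j) \<Rightarrow> binom_pow 1 1 (int m) i j)
        (B ((a, c) - (int m - int k, int k))))
      = Sum_any (\<lambda>k. scaleW (of_int (int m) gchoose k) (B (a - int m + int k, c - int k)))"
    by (intro Sum_any.cong) (simp add: binom_pow_def algebra_simps)
qed

text \<open>
  Without the factor \<open>(x\<^sub>0 + x\<^sub>2)\<^sup>m\<close>, both series of weak associativity are the product and iterate terms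
  in the plane \<open>b = -1\<close>; the factor moves that plane by \<open>m\<close>.
\<close>

lemma weak_associativity_iff:
  "weak_associativity scaleW Y YW u v w \<longleftrightarrow>
     (\<exists>m::nat. \<forall>a c. product_coeff u v w a (- 1 - int m) c = iterate_coeff u v w a (- 1 - int m) c)"
proof -
  let ?D = "\<lambda>a b c. product_coeff u v w a b c - iterate_coeff u v w a b c"
  let ?B = "\<lambda>e. assoc_product scaleW YW u v w e - iterate Y YW u v e w"
  have rec: "difference_recurrence ?D"
    by (intro difference_recurrence_diff difference_recurrence_product
        difference_recurrence_iterate)
  have "?B (a, c) = ?D a (- 1) c" for a c
    by (simp add: assoc_product_eq iterate_coeff_minus_one iterate_def)
  then have "series_mult scaleW (\<lambda>(i, j). binom_pow 1 1 (int m) i j) ?B (a, c)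
      = ?D a (- 1 - int m) c" for m a c
    using W.difference_recurrence_binomial_expansion[OF rec, of m a "- 1" c]
    by (simp only: series_mult_binom_pow)
  then show ?thesis
    unfolding weak_associativity_def fun_eq_iff split_paired_All by simp
qed

section \<open>Skew symmetry in coefficients\<close>

text \<open>
  The full three-variable form of skew symmetry, comparing
  \<open>x\<^sub>1\<^sup>-\<^sup>1 \<delta>((x\<^sub>2 + x\<^sub>0)/x\<^sub>1) Y\<^sub>W(Y(u,x\<^sub>0)v,x\<^sub>2) w\<close> with its image under \<open>u \<leftrightarrow> v\<close>, \<open>x\<^sub>1 \<leftrightarrow> x\<^sub>2\<close>, \<open>x\<^sub>0 \<mapsto> -x\<^sub>0\<close>.
  Vacuum-free skew symmetry is its residue in \<open>x\<^sub>1\<close>.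
\<close>

definition skew_defect :: "'v \<Rightarrow> 'v \<Rightarrow> 'w \<Rightarrow> int \<Rightarrow> int \<Rightarrow> int \<Rightarrow> 'w" where
  "skew_defect u v w a b c
     = iterate_coeff u v w a b c - scaleW ((- 1) powi a) (iterate_coeff v u w a c b)"

lemma subst_x2_plus_x0_negate_x0_iterate:
  "subst_x2_plus_x0 scaleW (negate_x0 scaleW (iterate Y YW v u)) (a, c) w
     = scaleW ((- 1) powi a) (iterate_coeff v u w a c (- 1))"
proof -
  let ?F = "\<lambda>(i, j). scaleW (binom_pow 1 1 j c (a - i))
    (negate_x0 scaleW (iterate Y YW v u) (i, j) w)"
  have sign: "(- 1 :: complex) powi (a - int k) = (- 1) powi a * (- 1) ^ k" for k
    by (simp add: power_int_diff field_simps)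
  have "Sum_any ?F = Sum_any (\<lambda>k. ?F (a - int k, c + int k))"
  proof (rule Sum_any_reindex)
    show "inj (\<lambda>k. (a - int k, c + int k))" by (simp add: inj_on_def)
  next
    fix d :: "int \<times> int"
    assume d: "d \<notin> range (\<lambda>k. (a - int k, c + int k))"
    obtain i j where ij: "d = (i, j)" by (cases d) auto
    have "a - i < 0 \<or> c + (a - i) \<noteq> j"
    proof (rule ccontr)
      assume "\<not> ?thesis"
      then have "d = (a - int (nat (a - i)), c + int (nat (a - i)))" using ij by simp
      then show False using d by blast
    qed
    then show "?F d = 0" by (auto simp: ij binom_pow_def)
  qed
  also have "\<dots> = Sum_any (\<lambda>k. scaleW ((- 1) powi a) (scaleW (of_int (- c - 1) gchoose k)
      (YW (Y v (a - int k) u) (c + - 1 + 1 + int k) w)))"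
    by (intro Sum_any.cong)
      (simp add: binom_pow_def negate_x0_def iterate_def sign
        gbinomial_upper_reflect[simplified] algebra_simps)
  also have "\<dots> = scaleW ((- 1) powi a) (iterate_coeff v u w a c (- 1))"
    unfolding iterate_coeff_def newton_sum_def by (rule W.scale_Sum_any[symmetric]) simp
  finally show ?thesis by (simp add: subst_x2_plus_x0_def)
qed

lemma vacuum_free_skew_symmetry_iff:
  "vacuum_free_skew_symmetry scaleW Y YW u v \<longleftrightarrow> (\<forall>w a c. skew_defect u v w a (- 1) c = 0)"
  unfolding vacuum_free_skew_symmetry_def fun_eq_iff split_paired_All
    subst_x2_plus_x0_negate_x0_iterate skew_defect_def
  by (auto simp: iterate_coeff_minus_one iterate_def)

lemma difference_recurrence_skew_defect: "difference_recurrence (skew_defect u v w)"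
  unfolding skew_defect_def
  by (intro difference_recurrence_diff W.difference_recurrence_swap_12 difference_recurrence_iterate)

text \<open>
  The residue in \<open>x\<^sub>1\<close> already determines the whole family: it gives the vanishing for \<open>b \<le> -1\<close>, and
  truncation gives it for very negative \<open>a\<close>.
\<close>

lemma skew_defect_eq_zero:
  assumes "vacuum_free_skew_symmetry scaleW Y YW u v"
  shows "skew_defect u v w a b c = 0"
proof -
  obtain N where N: "\<And>a b c. a \<le> N \<Longrightarrow> iterate_coeff u v w a b c = 0"
    using iterate_coeff_eventually_zero by blast
  obtain N' where N': "\<And>a b c. a \<le> N' \<Longrightarrow> iterate_coeff v u w a b c = 0"
    using iterate_coeff_eventually_zero by blast
  have base: "skew_defect u v w a (- 1) c = 0" for a c
    using assms by (simp add: vacuum_free_skew_symmetry_iff)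
  show ?thesis
  proof (rule difference_recurrence_unique[where F = "\<lambda>x y z. skew_defect u v w z y x"
        and a = c and b = b and c = a and b0 = "- 1" and c0 = "min N N'"])
    show "difference_recurrence (\<lambda>x y z. skew_defect u v w z y x)"
      by (rule difference_recurrence_swap_02[OF difference_recurrence_skew_defect])
    show "skew_defect u v w z y x = 0" if "y \<le> - 1" for x y z
      by (rule difference_recurrence_zero_below[OF difference_recurrence_skew_defect base that])
    show "skew_defect u v w z y x = 0" if "z \<le> min N N'" for x y z
      using that by (simp add: skew_defect_def N N')
  qed
qed

section \<open>Equivalence of the axioms\<close>

text \<open>
  The two product terms are interchanged by the symmetry, so only the iterate terms can tell the
  two defects apart.
\<close>

lemma jacobi_defect_swap:
  "jacobi_defect u v w a b c
     = scaleW ((- 1) powi a) (jacobi_defect v u w a c b) - skew_defect u v w a b c"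
proof -
  have "(- 1 :: complex) powi a * (- 1) powi a = 1"
    by (simp add: power_int_mult_distrib[symmetric])
  then show ?thesis
    by (simp add: jacobi_defect_def skew_defect_def YW.W.scale_right_distrib
        YW.W.scale_right_diff_distrib)
qed

text \<open>
  With \<open>m\<close> from weak associativity, for \<open>b \<le> -1 - m\<close> the product and iterate terms cancel, and for very negative \<open>b\<close> the remaining
  term vanishes because \<open>Y\<^sub>W(u,x\<^sub>1) w\<close> is truncated.
\<close>

lemma jacobi_defect_zero_below:
  assumes "weak_associativity scaleW Y YW u v w"
  shows "\<exists>N. \<forall>a b c. b \<le> N \<longrightarrow> jacobi_defect u v w a b c = 0"
proof -
  obtain m :: nat where
    m: "\<And>a c. product_coeff u v w a (- 1 - int m) c = iterate_coeff u v w a (- 1 - int m) c"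
    using assms weak_associativity_iff by blast
  obtain N where N: "\<And>a b c. c \<le> N \<Longrightarrow> product_coeff v u w a b c = 0"
    using product_coeff_eventually_zero by blast
  have "jacobi_defect u v w a b c = 0" if "b \<le> min N (- 1 - int m)" for a b c
  proof (rule difference_recurrence_zero_below[OF difference_recurrence_jacobi_defect _ that])
    have min: "min N (- 1 - int m) \<le> - 1 - int m" by simp
    have rec: "difference_recurrence
        (\<lambda>a b c. product_coeff u v w a b c - iterate_coeff u v w a b c)"
      by (intro difference_recurrence_diff difference_recurrence_product
          difference_recurrence_iterate)
    show "jacobi_defect u v w a (min N (- 1 - int m)) c = 0" for a c
      using difference_recurrence_zero_below[OF rec _ min] m N
      by (simp add: jacobi_defect_def)
  qed
  then show ?thesis by blast
qed

text \<open>
  If \<open>x\<^sup>m Y\<^sub>W(u,x) w\<close> has no negative powers, then multiplying the Jacobi identity by \<open>x\<^sub>1\<^sup>m\<close> and taking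
  the residue in \<open>x\<^sub>1\<close> removes the second term.
\<close>

lemma jacobi_identity_imp_weak_associativity:
  assumes "jacobi_identity scaleW Y YW u v w"
  shows "weak_associativity scaleW Y YW u v w"
proof -
  obtain N where N: "\<And>a b c. c \<le> N \<Longrightarrow> product_coeff v u w a b c = 0"
    using product_coeff_eventually_zero by blast
  \<comment> \<open>The exponent \<open>m = nat (- N)\<close> is chosen such that \<open>-1 - m \<le> N\<close>.\<close>
  have "product_coeff u v w a (- 1 - int (nat (- N))) c
      = iterate_coeff u v w a (- 1 - int (nat (- N))) c" for a c
  proof -
    have "product_coeff v u w a c (- 1 - int (nat (- N))) = 0" by (rule N) simp
    moreover have "jacobi_defect u v w a (- 1 - int (nat (- N))) c = 0"
      using assms by (simp add: jacobi_identity_iff)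
    ultimately show ?thesis by (simp add: jacobi_defect_def)
  qed
  then show ?thesis unfolding weak_associativity_iff by blast
qed

lemma jacobi_identity_imp_skew_symmetry:
  assumes "\<And>w. jacobi_identity scaleW Y YW u v w" "\<And>w. jacobi_identity scaleW Y YW v u w"
  shows "vacuum_free_skew_symmetry scaleW Y YW u v"
  unfolding vacuum_free_skew_symmetry_iff
proof (intro allI)
  fix w a c
  have "jacobi_defect u v w a (- 1) c = 0" "jacobi_defect v u w a c (- 1) = 0"
    using assms by (simp_all add: jacobi_identity_iff)
  then show "skew_defect u v w a (- 1) c = 0"
    using jacobi_defect_swap[of u v w a "- 1" c] by simp
qed

lemma jacobi_identityI:
  assumes "weak_associativity scaleW Y YW u v w" "weak_associativity scaleW Y YW v u w"
    and "vacuum_free_skew_symmetry scaleW Y YW u v"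
  shows "jacobi_identity scaleW Y YW u v w"
proof -
  obtain N where N: "\<And>a b c. b \<le> N \<Longrightarrow> jacobi_defect u v w a b c = 0"
    using jacobi_defect_zero_below[OF assms(1)] by blast
  obtain N' where N': "\<And>a b c. b \<le> N' \<Longrightarrow> jacobi_defect v u w a b c = 0"
    using jacobi_defect_zero_below[OF assms(2)] by blast
  have "jacobi_defect u v w a b c = 0" if "c \<le> N'" for a b c
    by (subst jacobi_defect_swap) (simp add: N'[OF that] skew_defect_eq_zero[OF assms(3)])
  then have "jacobi_defect u v w a b c = 0" for a b c
    using difference_recurrence_unique[OF difference_recurrence_jacobi_defect N] by blast
  then show ?thesis by (simp add: jacobi_identity_iff)
qed

end

theorem proposition5p4:
  fixes scaleV :: "complex \<Rightarrow> 'v::ab_group_add \<Rightarrow> 'v"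
    and scaleW :: "complex \<Rightarrow> 'w::ab_group_add \<Rightarrow> 'w"
    and Y :: "('v, 'v) vertex_map"
    and YW :: "('v, 'w) vertex_map"
  assumes "vacuum_free_vertex_algebra scaleV Y"
    and "truncated_vertex_map scaleV scaleW YW"
  shows "(\<forall>u v w. jacobi_identity scaleW Y YW u v w) \<longleftrightarrow>
    (\<forall>u v w. weak_associativity scaleW Y YW u v w) \<and>
    (\<forall>u v. vacuum_free_skew_symmetry scaleW Y YW u v)"
proof -
  interpret vertex_map_pair scaleV scaleW Y YW
    using assms by (simp add: vertex_map_pair_def vacuum_free_vertex_algebra_def)
  show ?thesis
    using jacobi_identity_imp_weak_associativity jacobi_identity_imp_skew_symmetry
      jacobi_identityI by blast
qed

end
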